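(* Let $f \in \mathbb{R}[x_1,\dots,x_n]$ be a homogeneous polynomial of degree $d$, hyperbolic with respect to $e \in \mathbb{R}^n$, and let $m=\max_{a \in \Lambda_+'} \mathrm{mult}(a)$. For every connected component $\mathcal{C}$ (in the Euclidean topology) of $\Gamma'_m$ with $\mathcal{C} \cap \Lambda_+ \neq \emptyset$, we have: (1) $\mathcal{C} \subset \Lambda_+$; and (2) $\mathcal{C} \cap \Gamma_{m+1} = \emptyset$.
   Context: A homogeneous polynomial $f\in\mathbb{R}[x]=\mathbb{R}[x_1,\dots,x_n]$ of degree $d$ is hyperbolic with respect to $e\in\mathbb{R}^n$ if $f(e)\neq 0$ and, for every $a\in\mathbb{R}^n$, the univariate polynomial $f(te-a)\in\mathbb{R}[t]$ has only real roots. Up to rescaling, $f$ is normalized so that $f(e)=1$. The characteristic polynomial of $a\in\mathbb{R}^n$ is $\mathrm{ch}_a(t)=f(te-a)$; its ordered roots $\lambda_1(a)\le\lambda_2(a)\le\cdots\le\lambda_d(a)$ are the eigenvalues of $a$. The multiplicity $\mathrm{mult}(a)$ is the multiplicity of $t=0$ as a root of $\mathrm{ch}_a(t)$ (equal to $0$ if $t=0$ is not a root). The hyperbolicity cone is $\Lambda_+=\{x\in\mathbb{R}^n : \lambda_1(x)\ge 0\}$, which is the Euclidean closure of the open cone $\Lambda_{++}=\{x\in\mathbb{R}^n:\lambda_1(x)>0\}$. Let $\Gamma_m=\{a\in\mathbb{R}^n : \mathrm{mult}(a)\ge m\}$ (in particular $\Gamma_{d+1}=\emptyset$). Let $L_e=\{x\in\mathbb{R}^n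 : e^Tx=1\}$, $\Lambda_+'=\Lambda_+\cap L_e$ (which is non-empty, as it contains $e/\|e\|^2$), and $\Gamma_m'=\Gamma_m\cap L_e$. *)

theory Defs
  imports
    "HOL-Analysis.Analysis"
    "HOL-Library.Poly_Mapping"
    "HOL-Computational_Algebra.Computational_Algebra"
begin

text \<open>
  A polynomial in the variables \<open>x\<^sub>i\<close>, \<open>i :: 'n\<close>, is a finitely supported map from
  exponent vectors to coefficients, so that the ring operations are those of
  \<^theory>\<open>HOL-Library.Poly_Mapping\<close>.
\<close>

type_synonym ('n, 'a) mpoly = "('n \<Rightarrow>\<^sub>0 nat) \<Rightarrow>\<^sub>0 'a"

definition homogeneous :: "nat \<Rightarrow> ('n::finite, 'a::zero) mpoly \<Rightarrow> bool" where
  "homogeneous d f \<longleftrightarrow>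
     (\<forall>\<alpha>\<in>Poly_Mapping.keys f. (\<Sum>i\<in>UNIV. Poly_Mapping.lookup \<alpha> i) = d)"

text \<open>
  Substitution of \<open>v i\<close> for \<open>x\<^sub>i\<close>, where \<open>\<phi>\<close> embeds the coefficients into the target ring.
\<close>

definition msubst :: "('a::zero \<Rightarrow> 'b::comm_semiring_1) \<Rightarrow> ('n::finite \<Rightarrow> 'b) \<Rightarrow> ('n, 'a) mpoly \<Rightarrow> 'b"
  where "msubst \<phi> v f =
    (\<Sum>\<alpha>\<in>Poly_Mapping.keys f.
       \<phi> (Poly_Mapping.lookup f \<alpha>) * (\<Prod>i\<in>UNIV. v i ^ Poly_Mapping.lookup \<alpha> i))"

definition meval :: "('n::finite, real) mpoly \<Rightarrow> real ^ 'n \<Rightarrow> real" where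
  "meval f x = msubst (\<lambda>c. c) (\<lambda>i. x $ i) f"

text \<open>
  \<open>f (t e - a)\<close> as a polynomial in \<open>t\<close>: the variable \<open>x\<^sub>i\<close> is replaced by the linear
  polynomial \<open>e\<^sub>i t - a\<^sub>i\<close>.
\<close>

definition charpoly :: "('n::finite, real) mpoly \<Rightarrow> real ^ 'n \<Rightarrow> real ^ 'n \<Rightarrow> real poly" where
  "charpoly f e a = msubst (\<lambda>c. [:c:]) (\<lambda>i. [:- (a $ i), e $ i:]) f"

lemma poly_charpoly: "poly (charpoly f e a) t = meval f (t *\<^sub>R e - a)"
  by (simp add: charpoly_def meval_def msubst_def poly_sum poly_prod algebra_simps)

text \<open>Homogeneity is assumed separately.\<close>

definition hyperbolic :: "('n::finite, real) mpoly \<Rightarrow> real ^ 'n \<Rightarrow> bool" where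
  "hyperbolic f e \<longleftrightarrow> meval f e \<noteq> 0 \<and>
     (\<forall>a. \<forall>z::complex. poly (map_poly complex_of_real (charpoly f e a)) z = 0 \<longrightarrow> z \<in> \<real>)"

text \<open>
  The roots of the characteristic polynomial, repeated according to multiplicity, in
  ascending order. For homogeneous hyperbolic \<open>f\<close> of degree \<open>d\<close> they are
  \<open>\<lambda>\<^sub>1(a) \<le> \<dots> \<le> \<lambda>\<^sub>d(a)\<close>; \<open>eigenvalue\<close> is indexed from 1 and is meaningful for
  \<open>1 \<le> k \<le> d\<close> only.
\<close>

definition eigenvalues :: "('n::finite, real) mpoly \<Rightarrow> real ^ 'n \<Rightarrow> real ^ 'n \<Rightarrow> real list" where
  "eigenvalues f e a = sorted_list_of_multiset (proots (charpoly f e a))"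

definition eigenvalue :: "('n::finite, real) mpoly \<Rightarrow> real ^ 'n \<Rightarrow> nat \<Rightarrow> real ^ 'n \<Rightarrow> real" where
  "eigenvalue f e k a = eigenvalues f e a ! (k - 1)"

definition eig_mult :: "('n::finite, real) mpoly \<Rightarrow> real ^ 'n \<Rightarrow> real ^ 'n \<Rightarrow> nat" where
  "eig_mult f e a = order 0 (charpoly f e a)"

definition hyp_cone :: "('n::finite, real) mpoly \<Rightarrow> real ^ 'n \<Rightarrow> (real ^ 'n) set" where
  "hyp_cone f e = {x. eigenvalue f e 1 x \<ge> 0}"

definition mult_locus :: "('n::finite, real) mpoly \<Rightarrow> real ^ 'n \<Rightarrow> nat \<Rightarrow> (real ^ 'n) set" where
  "mult_locus f e m = {a. eig_mult f e a \<ge> m}"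

definition slice :: "real ^ 'n::finite \<Rightarrow> (real ^ 'n) set" where
  "slice e = {x. e \<bullet> x = 1}"

end

theory Submission
  imports Defs
begin

text \<open>
  The position of the eigenvalues is read off from the signs of the coefficients of
  \<open>ch\<^sub>a(t) = f (t e - a)\<close>, which are visibly continuous in \<open>a\<close>, instead of from the
  roots themselves. Write \<open>d\<close> for the degree of \<open>f\<close>.

  A real-rooted polynomial has only nonnegative roots iff its coefficients weakly alternate
  in sign (\<open>nonneg_roots_iff_alternating\<close>). So, for \<open>d > 0\<close>, the cone \<open>\<Lambda>\<^sub>+\<close> is
  cut out by finitely many weak inequalities in the coefficients of \<open>ch\<^sub>a\<close> and is closed.
  If moreover \<open>0\<close> is a root of multiplicity exactly \<open>m\<close>, then the coefficients
  of \<open>t\<^sup>m, \<dots>, t\<^sup>d\<close> alternate strictly (\<open>nonneg_roots_imp_strictly_alternating\<close>), which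
  is an open condition \<open>U\<close> on \<open>a\<close>.

  Now let \<open>m\<close> be the maximal multiplicity on \<open>\<Lambda>\<^sub>+'\<close>. A point of
  \<open>\<Gamma>\<^sub>m' \<inter> \<Lambda>\<^sub>+\<close> has multiplicity exactly \<open>m\<close> and therefore lies in \<open>U\<close>.
  Conversely, on \<open>\<Gamma>\<^sub>m'\<close> the coefficients below \<open>t\<^sup>m\<close> vanish, so a point of
  \<open>\<Gamma>\<^sub>m' \<inter> U\<close> has weakly alternating coefficients and lies in \<open>\<Lambda>\<^sub>+\<close>. Hence
  \<open>\<Lambda>\<^sub>+\<close> and \<open>U\<close> have the same trace on \<open>\<Gamma>\<^sub>m'\<close>. This trace is open and
  closed, so a connected component that meets it is contained in it. The second claim follows:
  a component inside \<open>\<Lambda>\<^sub>+\<close> cannot carry a multiplicity above the maximum.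
\<close>

section \<open>Signs of the coefficients of real-rooted polynomials\<close>

definition real_rooted :: "real poly \<Rightarrow> bool" where
  "real_rooted p \<longleftrightarrow> (\<forall>z::complex. poly (map_poly complex_of_real p) z = 0 \<longrightarrow> z \<in> \<real>)"

lemma poly_map_poly_of_real:
  "poly (map_poly of_real p) (of_real x :: 'a::{real_algebra_1, comm_ring_1}) = of_real (poly p x)"
  by (induction p) (simp_all add: map_poly_pCons)

lemma map_poly_of_real_mult:
  "map_poly of_real (p * q) =
    (map_poly of_real p * map_poly of_real q :: 'a::{real_algebra_1, comm_ring_1} poly)"
  by (rule poly_eqI) (simp add: coeff_map_poly coeff_mult)

lemma real_rooted_factor:
  assumes "real_rooted (p * q)"
  shows "real_rooted q"
  using assms by (auto simp: real_rooted_def map_poly_of_real_mult)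

lemma real_rooted_obtains_root:
  assumes "real_rooted p" and "degree p > 0"
  obtains r where "poly p r = 0"
proof -
  have "degree (map_poly complex_of_real p) = degree p"
    by (rule degree_map_poly) simp
  then have "\<not> constant (poly (map_poly complex_of_real p))"
    using assms(2) by (simp add: constant_degree)
  then obtain z where z: "poly (map_poly complex_of_real p) z = 0"
    using fundamental_theorem_of_algebra by blast
  then obtain r where "z = complex_of_real r"
    using assms(1) by (auto simp: real_rooted_def elim: Reals_cases)
  with z have "poly p r = 0"
    by (simp add: poly_map_poly_of_real)
  then show thesis by (rule that)
qed

lemma lead_coeff_square_pos: "p \<noteq> 0 \<Longrightarrow> 0 < lead_coeff p * lead_coeff p" for p :: "real poly"
  by (metis not_real_square_gt_zero leading_coeff_neq_0)

text \<open>
  Splitting off one root \<open>r > 0\<close> replaces the coefficients \<open>q\<^sub>k\<close> by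
  \<open>q\<^sub>k\<^sub>-\<^sub>1 - r q\<^sub>k\<close>, and if the \<open>q\<^sub>k\<close> alternate in sign then both terms have the same sign.
\<close>

lemma pos_roots_imp_alternating:
  assumes "real_rooted p" and "p \<noteq> 0" and "\<And>t. poly p t = 0 \<Longrightarrow> t > 0" and "k \<le> degree p"
  shows "0 < (- 1) ^ (degree p + k) * lead_coeff p * coeff p k"
  using assms
proof (induction "degree p" arbitrary: p k)
  case 0
  then show ?case
    using lead_coeff_square_pos[of p] by simp
next
  case (Suc n)
  obtain r where r: "poly p r = 0"
    using real_rooted_obtains_root[of p] Suc.hyps(2) Suc.prems(1) by auto
  then obtain q where p: "p = [:- r, 1:] * q"
    by (auto simp: poly_eq_0_iff_dvd elim: dvdE)
  have "r > 0" using r Suc.prems(3) by blast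
  have "q \<noteq> 0" using p Suc.prems(2) by auto
  have deg: "degree p = Suc (degree q)"
    unfolding p using \<open>q \<noteq> 0\<close> by (subst degree_mult_eq) auto
  have lead: "lead_coeff p = lead_coeff q"
    unfolding p by (subst lead_coeff_mult) simp
  have "real_rooted q"
    using Suc.prems(1) unfolding p by (rule real_rooted_factor)
  moreover have "t > 0" if "poly q t = 0" for t
    using that Suc.prems(3)[of t] by (simp add: p)
  ultimately have IH: "0 < (- 1) ^ (degree q + j) * lead_coeff q * coeff q j"
    if "j \<le> degree q" for j
    using Suc.hyps(1)[of q j] Suc.hyps(2) deg \<open>q \<noteq> 0\<close> that by simp
  show ?case
  proof (cases k)
    case 0
    have "0 < r * ((- 1) ^ (degree q + 0) * lead_coeff q * coeff q 0)"
      by (rule mult_pos_pos[OF \<open>r > 0\<close> IH]) simp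
    also have "\<dots> = (- 1) ^ (degree p + k) * lead_coeff p * coeff p k"
      unfolding deg lead[unfolded deg] 0 by (simp add: p algebra_simps)
    finally show ?thesis .
  next
    case (Suc j)
    have "j \<le> degree q" using Suc Suc.prems(4) deg by simp
    then have "0 < (- 1) ^ (degree q + j) * lead_coeff q * coeff q j"
      by (rule IH)
    moreover have "0 \<le> r * ((- 1) ^ (degree q + Suc j) * lead_coeff q * coeff q (Suc j))"
    proof (cases "Suc j \<le> degree q")
      case True
      show ?thesis
        using mult_pos_pos[OF \<open>r > 0\<close> IH[OF True]] by (rule less_imp_le)
    next
      case False
      then show ?thesis by (simp add: coeff_eq_0)
    qed
    moreover have "(- 1) ^ (degree p + k) * lead_coeff p * coeff p k =
        (- 1) ^ (degree q + j) * lead_coeff q * coeff q j +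
        r * ((- 1) ^ (degree q + Suc j) * lead_coeff q * coeff q (Suc j))"
      unfolding deg lead[unfolded deg] Suc by (simp add: p algebra_simps)
    ultimately show ?thesis by linarith
  qed
qed

text \<open>Dividing by the exact power of \<open>t\<close> leaves a polynomial with positive roots only.\<close>

lemma nonneg_roots_imp_strictly_alternating:
  assumes "real_rooted p" and "p \<noteq> 0" and nonneg: "\<And>t. poly p t = 0 \<Longrightarrow> t \<ge> 0"
    and "order 0 p \<le> k" and "k \<le> degree p"
  shows "0 < (- 1) ^ (degree p + k) * lead_coeff p * coeff p k"
proof -
  let ?m = "order 0 p"
  obtain q where p: "p = monom 1 ?m * q" and q0: "poly q 0 \<noteq> 0"
    using order_decomp[OF assms(2), of 0] by (auto simp: monom_altdef poly_eq_0_iff_dvd)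
  have "q \<noteq> 0" using q0 by auto
  have deg: "degree p = ?m + degree q"
    by (subst p, subst degree_mult_eq) (use \<open>q \<noteq> 0\<close> in \<open>auto simp: degree_monom_eq\<close>)
  have lead: "lead_coeff p = lead_coeff q"
    using arg_cong[OF p, of lead_coeff]
    by (simp only: lead_coeff_mult lead_coeff_monom mult_1_left)
  have co: "coeff p k = coeff q (k - ?m)"
    by (subst p) (use assms(4) in \<open>simp add: coeff_monom_mult\<close>)
  have "real_rooted q"
    using assms(1) p real_rooted_factor by metis
  moreover have "t > 0" if "poly q t = 0" for t
  proof -
    have "poly p t = 0" by (subst p) (simp add: that)
    then have "t \<ge> 0" by (rule nonneg)
    moreover have "t \<noteq> 0" using that q0 by auto
    ultimately show ?thesis by simp
  qed
  ultimately have "0 < (- 1) ^ (degree q + (k - ?m)) * lead_coeff q * coeff q (k - ?m)"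
    using \<open>q \<noteq> 0\<close> assms(5) deg by (intro pos_roots_imp_alternating) auto
  moreover have "(- 1 :: real) ^ (degree p + k) = (- 1) ^ (degree q + (k - ?m))"
  proof -
    have "degree p + k = 2 * ?m + (degree q + (k - ?m))"
      using deg assms(4) by simp
    then show ?thesis by (simp only: power_add power_mult) simp
  qed
  ultimately show ?thesis
    unfolding lead co by simp
qed

lemma coeff_eq_0_if_less_order_0:
  assumes "k < order 0 p"
  shows "coeff p k = 0"
proof (cases "p = 0")
  case False
  then show ?thesis
    using assms monom_1_dvd_iff[of p "order 0 p"] by (simp add: monom_1_dvd_iff')
qed simp

text \<open>
  At \<open>t < 0\<close> all terms \<open>p\<^sub>k t\<^sup>k\<close> of a polynomial with alternating coefficients have the
  same sign, and the leading one is nonzero.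
\<close>

lemma alternating_imp_nonneg_roots:
  assumes "p \<noteq> 0"
    and alt: "\<And>k. k \<le> degree p \<Longrightarrow> 0 \<le> (- 1) ^ (degree p + k) * lead_coeff p * coeff p k"
    and root: "poly p t = 0"
  shows "t \<ge> (0 :: real)"
proof (rule ccontr)
  assume "\<not> t \<ge> 0"
  then have s: "0 < - t" by simp
  let ?g = "\<lambda>k. ((- 1) ^ (degree p + k) * lead_coeff p * coeff p k) * (- t) ^ k"
  have g: "?g k = (- 1) ^ degree p * lead_coeff p * (coeff p k * t ^ k)" for k
  proof -
    have "(- t) ^ k = (- 1) ^ k * t ^ k" by (rule power_minus)
    moreover have "(- 1 :: real) ^ k * (- 1) ^ k = 1"
      by (simp flip: power_mult_distrib)
    ultimately show ?thesis by (simp add: power_add algebra_simps)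
  qed
  have "?g (degree p) = lead_coeff p * lead_coeff p * (- t) ^ degree p"
    by (simp flip: mult_2)
  then have "0 < ?g (degree p)"
    using s lead_coeff_square_pos[OF assms(1)] by (simp only: mult_pos_pos zero_less_power)
  moreover have "0 \<le> ?g k" if "k \<le> degree p" for k
    by (rule mult_nonneg_nonneg[OF alt[OF that]]) (use s in simp)
  ultimately have "0 < (\<Sum>k\<le>degree p. ?g k)"
    by (intro sum_pos2[of _ "degree p"]) auto
  also have "(\<Sum>k\<le>degree p. ?g k) = (- 1) ^ degree p * lead_coeff p * poly p t"
    unfolding g poly_altdef by (simp add: sum_distrib_left)
  finally show False using root by simp
qed

lemma nonneg_roots_iff_alternating:
  assumes "real_rooted p" and "p \<noteq> 0"
  shows "(\<forall>t. poly p t = 0 \<longrightarrow> t \<ge> 0) \<longleftrightarrow>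
    (\<forall>k\<le>degree p. 0 \<le> (- 1) ^ (degree p + k) * lead_coeff p * coeff p k)"
proof (intro iffI allI impI)
  fix k assume "\<forall>t. poly p t = 0 \<longrightarrow> t \<ge> 0" and k: "k \<le> degree p"
  then show "0 \<le> (- 1) ^ (degree p + k) * lead_coeff p * coeff p k"
    using nonneg_roots_imp_strictly_alternating[OF assms, of k]
    by (cases "order 0 p \<le> k") (auto simp: coeff_eq_0_if_less_order_0 less_imp_le)
qed (use alternating_imp_nonneg_roots assms in blast)

section \<open>Coefficients of the characteristic polynomial\<close>

lemma coeff_mult_at_bounds:
  fixes p q :: "'a::comm_semiring_0 poly"
  assumes "degree p \<le> m" and "degree q \<le> n"
  shows "coeff (p * q) (m + n) = coeff p m * coeff q n"
proof -
  have "coeff p i * coeff q (m + n - i) = 0" if "i \<noteq> m" for i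
    using that assms by (cases "i < m") (auto simp: coeff_eq_0)
  then have "(\<Sum>i\<le>m + n. coeff p i * coeff q (m + n - i)) =
      (\<Sum>i\<in>{m}. coeff p i * coeff q (m + n - i))"
    by (intro sum.mono_neutral_right) auto
  then show ?thesis by (simp add: coeff_mult)
qed

lemma degree_coeff_linear_power:
  fixes b c :: "'a::comm_semiring_1"
  shows "degree ([:b, c:] ^ n) \<le> n \<and> coeff ([:b, c:] ^ n) n = c ^ n"
proof (induction n)
  case (Suc n)
  have "degree [:b, c:] \<le> 1" by simp
  then show ?case
    using Suc coeff_mult_at_bounds[of "[:b, c:]" 1 "[:b, c:] ^ n" n]
      degree_mult_le[of "[:b, c:]" "[:b, c:] ^ n"]
    by (simp del: mult_pCons_left)
qed simp

lemma degree_coeff_prod_linear_power: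
  fixes b c :: "'i \<Rightarrow> 'a::comm_semiring_1"
  assumes "finite A"
  shows "degree (\<Prod>i\<in>A. [:b i, c i:] ^ n i) \<le> (\<Sum>i\<in>A. n i) \<and>
    coeff (\<Prod>i\<in>A. [:b i, c i:] ^ n i) (\<Sum>i\<in>A. n i) = (\<Prod>i\<in>A. c i ^ n i)"
  using assms
proof (induction A)
  case (insert j A)
  let ?p = "[:b j, c j:] ^ n j" and ?q = "\<Prod>i\<in>A. [:b i, c i:] ^ n i"
  have "degree (?p * ?q) \<le> n j + (\<Sum>i\<in>A. n i)"
    using degree_mult_le[of ?p ?q] insert.IH degree_coeff_linear_power[of "b j" "c j" "n j"]
    by linarith
  then show ?case
    using insert coeff_mult_at_bounds[of ?p "n j" ?q "\<Sum>i\<in>A. n i"]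
      degree_coeff_linear_power[of "b j" "c j" "n j"] by simp
qed simp

lemma
  assumes "homogeneous d f"
  shows degree_charpoly_le: "degree (charpoly f e a) \<le> d"
    and coeff_charpoly_top: "coeff (charpoly f e a) d = meval f e"
proof -
  let ?P = "\<lambda>\<alpha>. \<Prod>i\<in>UNIV. [:- (a $ i), e $ i:] ^ Poly_Mapping.lookup \<alpha> i"
  have P: "degree (?P \<alpha>) \<le> d \<and>
      coeff (?P \<alpha>) d = (\<Prod>i\<in>UNIV. (e $ i) ^ Poly_Mapping.lookup \<alpha> i)"
    if "\<alpha> \<in> Poly_Mapping.keys f" for \<alpha>
    using degree_coeff_prod_linear_power[of UNIV "\<lambda>i. - (a $ i)" "\<lambda>i. e $ i"
        "Poly_Mapping.lookup \<alpha>"] assms that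
    by (simp add: homogeneous_def)
  show "degree (charpoly f e a) \<le> d"
    unfolding charpoly_def msubst_def
    by (intro degree_sum_le) (use P in \<open>auto intro: order.trans[OF degree_smult_le]\<close>)
  show "coeff (charpoly f e a) d = meval f e"
    unfolding charpoly_def msubst_def meval_def coeff_sum
    by (intro sum.cong) (use P in auto)
qed

lemma
  assumes "homogeneous d f" and "hyperbolic f e"
  shows degree_charpoly: "degree (charpoly f e a) = d"
    and charpoly_nonzero: "charpoly f e a \<noteq> 0"
    and real_rooted_charpoly: "real_rooted (charpoly f e a)"
proof -
  have "coeff (charpoly f e a) d \<noteq> 0"
    using assms by (simp add: coeff_charpoly_top hyperbolic_def)
  then show "degree (charpoly f e a) = d" and "charpoly f e a \<noteq> 0"
    using degree_charpoly_le[OF assms(1), of e a] le_degree[of "charpoly f e a" d] by auto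
  show "real_rooted (charpoly f e a)"
    using assms(2) by (simp add: hyperbolic_def real_rooted_def)
qed

lemma continuous_coeff_mult:
  fixes P Q :: "'a::topological_space \<Rightarrow> 'b::{comm_semiring_0, topological_semigroup_mult,
    topological_comm_monoid_add} poly"
  assumes "\<And>k. continuous_on S (\<lambda>x. coeff (P x) k)" "\<And>k. continuous_on S (\<lambda>x. coeff (Q x) k)"
  shows "continuous_on S (\<lambda>x. coeff (P x * Q x) k)"
  unfolding coeff_mult by (intro continuous_intros assms)

lemma continuous_coeff_power:
  fixes P :: "'a::topological_space \<Rightarrow> 'b::{comm_semiring_1, topological_semigroup_mult,
    topological_comm_monoid_add} poly"
  assumes "\<And>k. continuous_on S (\<lambda>x. coeff (P x) k)"
  shows "continuous_on S (\<lambda>x. coeff (P x ^ n) k)"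
  by (induction n arbitrary: k) (simp_all add: continuous_coeff_mult assms)

lemma continuous_coeff_prod:
  fixes P :: "'i \<Rightarrow> 'a::topological_space \<Rightarrow> 'b::{comm_semiring_1, topological_semigroup_mult,
    topological_comm_monoid_add} poly"
  assumes "\<And>i k. continuous_on S (\<lambda>x. coeff (P i x) k)"
  shows "continuous_on S (\<lambda>x. coeff (\<Prod>i\<in>A. P i x) k)"
  by (induction A arbitrary: k rule: infinite_finite_induct)
    (simp_all add: continuous_coeff_mult assms)

lemma continuous_coeff_charpoly: "continuous_on S (\<lambda>a. coeff (charpoly f e a) k)"
proof -
  have "continuous_on S (\<lambda>a. coeff [:- (a $ i), e $ i:] k)" for i k
    by (cases k; cases "k - 1") (auto intro!: continuous_intros)
  then have "continuous_on S (\<lambda>a. coeff (\<Prod>i\<in>UNIV. [:- (a $ i), e $ i:] ^ n i) k)"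
    for n :: "'a \<Rightarrow> nat" and k
    by (intro continuous_coeff_prod continuous_coeff_power)
  then show ?thesis
    unfolding charpoly_def msubst_def coeff_sum
    by (auto intro!: continuous_intros)
qed

section \<open>The hyperbolicity cone\<close>

text \<open>
  In degree \<open>0\<close> there is no smallest eigenvalue: the value of \<open>eigenvalue f e 1\<close> is then an
  unspecified real, hence the assumption \<open>d > 0\<close>.
\<close>

lemma mem_hyp_cone_iff_nonneg_roots:
  assumes "homogeneous d f" and "hyperbolic f e" and "d > 0"
  shows "a \<in> hyp_cone f e \<longleftrightarrow> (\<forall>t. poly (charpoly f e a) t = 0 \<longrightarrow> t \<ge> 0)"
proof -
  let ?p = "charpoly f e a"
  let ?xs = "sorted_list_of_multiset (proots ?p)"
  have nz: "?p \<noteq> 0"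
    using assms by (simp add: charpoly_nonzero)
  then have set: "set ?xs = {t. poly ?p t = 0}"
    by simp
  obtain r where "poly ?p r = 0"
    using real_rooted_obtains_root[of ?p] assms by (auto simp: real_rooted_charpoly degree_charpoly)
  then obtain x xs where xs: "?xs = x # xs"
    using set by (cases ?xs) auto
  have "sorted ?xs" by simp
  then have "(\<forall>t\<in>set ?xs. t \<ge> 0) \<longleftrightarrow> ?xs ! 0 \<ge> 0"
    unfolding xs by auto
  then show ?thesis
    unfolding set by (simp add: hyp_cone_def eigenvalue_def eigenvalues_def)
qed

lemma mem_hyp_cone_iff_alternating:
  assumes "homogeneous d f" and "hyperbolic f e" and "d > 0"
  shows "a \<in> hyp_cone f e \<longleftrightarrow>
    (\<forall>k\<le>d. 0 \<le> (- 1) ^ (d + k) * meval f e * coeff (charpoly f e a) k)"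
  using nonneg_roots_iff_alternating[of "charpoly f e a"] assms
  by (simp add: mem_hyp_cone_iff_nonneg_roots real_rooted_charpoly charpoly_nonzero
      degree_charpoly coeff_charpoly_top)

lemma hyp_cone_strictly_alternating:
  assumes "homogeneous d f" and "hyperbolic f e" and "d > 0"
    and "a \<in> hyp_cone f e" and "eig_mult f e a \<le> k" and "k \<le> d"
  shows "0 < (- 1) ^ (d + k) * meval f e * coeff (charpoly f e a) k"
  using nonneg_roots_imp_strictly_alternating[of "charpoly f e a" k] assms
  by (simp add: mem_hyp_cone_iff_nonneg_roots real_rooted_charpoly charpoly_nonzero
      eig_mult_def degree_charpoly coeff_charpoly_top)

lemma closed_hyp_cone:
  assumes "homogeneous d f" and "hyperbolic f e" and "d > 0"
  shows "closed (hyp_cone f e)"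
proof -
  have "hyp_cone f e =
      {a. \<forall>k. k \<le> d \<longrightarrow> 0 \<le> (- 1) ^ (d + k) * meval f e * coeff (charpoly f e a) k}"
    using mem_hyp_cone_iff_alternating[OF assms] by auto
  also have "closed \<dots>"
    by (intro closed_Collect_all closed_Collect_imp closed_Collect_le
        continuous_on_mult_left continuous_on_const continuous_coeff_charpoly) simp
  finally show ?thesis .
qed

text \<open>
  On \<open>S\<close> the coefficients below \<open>t\<^sup>m\<close> vanish, and at points of the cone the others
  alternate strictly because \<open>0\<close> has multiplicity exactly \<open>m\<close> there. So on \<open>S\<close> the
  cone is also described by strict inequalities, for the coefficients of
  \<open>t\<^sup>m, \<dots>, t\<^sup>d\<close> only.
\<close>

lemma openin_mult_locus_Int_hyp_cone:
  assumes f: "homogeneous d f" "hyperbolic f e" "d > 0"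
    and S: "S \<subseteq> mult_locus f e m"
    and max: "\<And>a. a \<in> S \<inter> hyp_cone f e \<Longrightarrow> eig_mult f e a \<le> m"
  shows "openin (top_of_set S) (S \<inter> hyp_cone f e)"
proof -
  let ?c = "\<lambda>a k. (- 1) ^ (d + k) * meval f e * coeff (charpoly f e a) k"
  let ?U = "\<Inter>k\<in>{m..d}. {a. 0 < ?c a k}"
  have "open ?U"
    by (intro open_INT ballI open_Collect_less continuous_on_mult_left continuous_on_const
        continuous_coeff_charpoly) simp
  moreover have "S \<inter> hyp_cone f e = S \<inter> ?U"
  proof (intro equalityI subsetI)
    fix a assume "a \<in> S \<inter> hyp_cone f e"
    then show "a \<in> S \<inter> ?U"
      using max hyp_cone_strictly_alternating[OF f] order.trans by fastforce
  next
    fix a assume a: "a \<in> S \<inter> ?U"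
    have "0 \<le> ?c a k" if "k \<le> d" for k
    proof (cases "m \<le> k")
      case True
      then have "0 < ?c a k" using a that by auto
      then show ?thesis by simp
    next
      case False
      then have "k < order 0 (charpoly f e a)"
        using a S by (auto simp: mult_locus_def eig_mult_def)
      then show ?thesis by (simp add: coeff_eq_0_if_less_order_0)
    qed
    then show "a \<in> S \<inter> hyp_cone f e"
      using a mem_hyp_cone_iff_alternating[OF f] by auto
  qed
  ultimately show ?thesis by (simp add: openin_open_Int)
qed

lemma eig_mult_le_Max:
  assumes "homogeneous d f" and "hyperbolic f e" and "a \<in> A"
  shows "eig_mult f e a \<le> Max (eig_mult f e ` A)"
proof (rule Max_ge)
  have "eig_mult f e b \<le> d" for b
    unfolding eig_mult_def using assms(1,2) order_degree[of "charpoly f e b" 0]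
    by (simp add: charpoly_nonzero degree_charpoly)
  then show "finite (eig_mult f e ` A)"
    by (auto intro: finite_subset[OF _ finite_atMost[of d]])
qed (use assms(3) in simp)

section \<open>Components of the multiplicity locus\<close>

theorem proposition6:
  fixes f :: "('n::finite, real) mpoly" and e :: "real ^ 'n" and d m :: nat
    and C :: "(real ^ 'n) set"
  assumes "homogeneous d f"
    and "hyperbolic f e"
    and "m = Max (eig_mult f e ` (hyp_cone f e \<inter> slice e))"
    and "C \<in> components (mult_locus f e m \<inter> slice e)"
    and "C \<inter> hyp_cone f e \<noteq> {}"
  shows "C \<subseteq> hyp_cone f e \<and> C \<inter> mult_locus f e (m + 1) = {}"
proof
  have C: "C \<subseteq> mult_locus f e m" "C \<subseteq> slice e" "connected C"
    using assms(4) in_components_subset in_components_connected by blast+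
  have max: "eig_mult f e a \<le> m" if "a \<in> C \<inter> hyp_cone f e" for a
    unfolding assms(3) using assms(1,2) C(2) that by (intro eig_mult_le_Max) auto
  show sub: "C \<subseteq> hyp_cone f e"
  proof (cases "d = 0")
    case True
    \<comment> \<open>The characteristic polynomials are nonzero constants, so membership in the cone
      does not depend on the point.\<close>
    have "proots (charpoly f e a) = {#}" for a
    proof -
      have "degree (charpoly f e a) = 0"
        using degree_charpoly[OF assms(1,2)] True by simp
      then show ?thesis by (auto elim: degree_eq_zeroE)
    qed
    then have "hyp_cone f e = UNIV \<or> hyp_cone f e = {}"
      by (auto simp: hyp_cone_def eigenvalue_def eigenvalues_def)
    then show ?thesis using assms(5) by auto
  next
    case False
    then have d: "d > 0" by simp
    have "openin (top_of_set C) (C \<inter> hyp_cone f e)"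
      using assms(1,2) d C(1) max by (rule openin_mult_locus_Int_hyp_cone)
    moreover have "closedin (top_of_set C) (C \<inter> hyp_cone f e)"
      using closed_hyp_cone[OF assms(1,2) d] by (simp add: closedin_closed_Int)
    ultimately show ?thesis
      using C(3) assms(5) unfolding connected_clopen by blast
  qed
  show "C \<inter> mult_locus f e (m + 1) = {}"
    using max sub by (fastforce simp: mult_locus_def)
qed

end
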